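(* Let $\mathbb{P}=(R,G)$ be a skew partial field and let $C$ be a $\mathbb{P}$-chain group on a finite set $E$. Let $\mathbb{P}'=(R',G')$ be a skew partial field, and let $\phi:R\to R'$ be a ring homomorphism such that $\phi(G)\subseteq G'$. Then $\phi(C)$ is a $\mathbb{P}'$-chain group, and $M(C)=M(\phi(C))$.
   Context: A skew partial field is a pair $\mathbb{P}=(R,G)$ with $R$ a (not necessarily commutative) ring with identity and $G$ a subgroup of the units $R^*$ with $-1\in G$. An $R$-chain group on $E$ is a subset of $R^E$ containing $0$ and closed under componentwise addition and left scalar multiplication. For a chain $c$, $\|c\|=\{e:c_e\neq0\}$; $c$ is elementary in $C$ if $c\neq0$ and no nonzero chain of $C$ has support strictly contained in $\|c\|$; $c$ is $G$-primitive if its entries lie in $G\cup\{0\}$. A $\mathbb{P}$-chain group is an $R$-chain group in which every elementary chain equals $rc'$ for some $r\in R$ and $G$-primitive $c'$ in the group; $M(C)$ is the matroid on $E$ whose cocircuits are the supports of its elementary chains. Here $\phi(C)$ denotes the $R'$-chain group on $E$ generated by the componentwise images $\phi(c)=(\phi(c_e))_{e\in E}$, $c\in C$ (i.e. all $R'$-linear combinations $\sum r'_i\phi(c_i)$). *)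

theory Defs
  imports "HOL-Algebra.RingHom" "HOL.Hull"
begin

section \<open>Matroids\<close>

record 'e matroid =
  ground :: "'e set"
  indep :: "'e set set"

definition is_matroid :: "'e matroid \<Rightarrow> bool" where
  "is_matroid M \<longleftrightarrow>
     finite (ground M) \<and> indep M \<subseteq> Pow (ground M) \<and> {} \<in> indep M \<and>
     (\<forall>I\<in>indep M. \<forall>J. J \<subseteq> I \<longrightarrow> J \<in> indep M) \<and>
     (\<forall>I\<in>indep M. \<forall>J\<in>indep M. card I < card J \<longrightarrow> (\<exists>e\<in>J - I. insert e I \<in> indep M))"

definition bases :: "'e matroid \<Rightarrow> 'e set set" where
  "bases M = {B \<in> indep M. \<forall>I\<in>indep M. B \<subseteq> I \<longrightarrow> I = B}"

definition circuits :: "'e matroid \<Rightarrow> 'e set set" where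
  "circuits M = {X. X \<subseteq> ground M \<and> X \<notin> indep M \<and> (\<forall>Y. Y \<subset> X \<longrightarrow> Y \<in> indep M)}"

definition dual :: "'e matroid \<Rightarrow> 'e matroid" where
  "dual M = \<lparr>ground = ground M, indep = {I. I \<subseteq> ground M \<and> (\<exists>B\<in>bases M. I \<inter> B = {})}\<rparr>"

definition cocircuits :: "'e matroid \<Rightarrow> 'e set set" where
  "cocircuits M = circuits (dual M)"


section \<open>Skew partial fields and chain groups\<close>

text \<open>
  Rings in HOL-Algebra may be trivial; as usual for rings with identity, \<open>1 \<noteq> 0\<close> is required.
\<close>

definition skew_partial_field :: "('a, 'm) ring_scheme \<Rightarrow> 'a set \<Rightarrow> bool" where
  "skew_partial_field R G \<longleftrightarrow>
     ring R \<and> \<one>\<^bsub>R\<^esub> \<noteq> \<zero>\<^bsub>R\<^esub> \<and> subgroup G (units_of R) \<and> \<ominus>\<^bsub>R\<^esub> \<one>\<^bsub>R\<^esub> \<in> G"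

text \<open>A chain on \<open>E\<close> is an element of \<open>E \<rightarrow>\<^sub>E carrier R\<close>.\<close>

definition zero_chain :: "('a, 'm) ring_scheme \<Rightarrow> 'e set \<Rightarrow> 'e \<Rightarrow> 'a" where
  "zero_chain R E = (\<lambda>e\<in>E. \<zero>\<^bsub>R\<^esub>)"

definition add_chain :: "('a, 'm) ring_scheme \<Rightarrow> 'e set \<Rightarrow> ('e \<Rightarrow> 'a) \<Rightarrow> ('e \<Rightarrow> 'a) \<Rightarrow> 'e \<Rightarrow> 'a" where
  "add_chain R E c d = (\<lambda>e\<in>E. c e \<oplus>\<^bsub>R\<^esub> d e)"

definition scale_chain :: "('a, 'm) ring_scheme \<Rightarrow> 'e set \<Rightarrow> 'a \<Rightarrow> ('e \<Rightarrow> 'a) \<Rightarrow> 'e \<Rightarrow> 'a" where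
  "scale_chain R E r c = (\<lambda>e\<in>E. r \<otimes>\<^bsub>R\<^esub> c e)"

definition chain_group :: "('a, 'm) ring_scheme \<Rightarrow> 'e set \<Rightarrow> ('e \<Rightarrow> 'a) set \<Rightarrow> bool" where
  "chain_group R E C \<longleftrightarrow>
     C \<subseteq> (E \<rightarrow>\<^sub>E carrier R) \<and> zero_chain R E \<in> C \<and>
     (\<forall>c\<in>C. \<forall>d\<in>C. add_chain R E c d \<in> C) \<and>
     (\<forall>r\<in>carrier R. \<forall>c\<in>C. scale_chain R E r c \<in> C)"

definition chain_support :: "('a, 'm) ring_scheme \<Rightarrow> 'e set \<Rightarrow> ('e \<Rightarrow> 'a) \<Rightarrow> 'e set" where
  "chain_support R E c = {e \<in> E. c e \<noteq> \<zero>\<^bsub>R\<^esub>}"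

definition elementary ::
  "('a, 'm) ring_scheme \<Rightarrow> 'e set \<Rightarrow> ('e \<Rightarrow> 'a) set \<Rightarrow> ('e \<Rightarrow> 'a) \<Rightarrow> bool" where
  "elementary R E C c \<longleftrightarrow>
     c \<in> C \<and> c \<noteq> zero_chain R E \<and>
     \<not> (\<exists>d\<in>C. d \<noteq> zero_chain R E \<and> chain_support R E d \<subset> chain_support R E c)"

definition primitive ::
  "('a, 'm) ring_scheme \<Rightarrow> 'a set \<Rightarrow> 'e set \<Rightarrow> ('e \<Rightarrow> 'a) \<Rightarrow> bool" where
  "primitive R G E c \<longleftrightarrow> (\<forall>e\<in>E. c e \<in> G \<union> {\<zero>\<^bsub>R\<^esub>})"

definition pf_chain_group ::
  "('a, 'm) ring_scheme \<Rightarrow> 'a set \<Rightarrow> 'e set \<Rightarrow> ('e \<Rightarrow> 'a) set \<Rightarrow> bool" where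
  "pf_chain_group R G E C \<longleftrightarrow>
     chain_group R E C \<and>
     (\<forall>c. elementary R E C c \<longrightarrow>
        (\<exists>r\<in>carrier R. \<exists>c'\<in>C. primitive R G E c' \<and> c = scale_chain R E r c'))"

text \<open>
  That the following description is satisfied by exactly one matroid, for any chain group over a
  skew partial field on a finite set, is lemma \<open>matroid_of_chain_group\<close> below.
\<close>

definition matroid_of ::
  "('a, 'm) ring_scheme \<Rightarrow> 'e set \<Rightarrow> ('e \<Rightarrow> 'a) set \<Rightarrow> 'e matroid" where
  "matroid_of R E C =
     (THE M. is_matroid M \<and> ground M = E \<and>
             cocircuits M = chain_support R E ` {c. elementary R E C c})"

definition image_chain :: "'e set \<Rightarrow> ('a \<Rightarrow> 'b) \<Rightarrow> ('e \<Rightarrow> 'a) \<Rightarrow> 'e \<Rightarrow> 'b" where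
  "image_chain E \<phi> c = (\<lambda>e\<in>E. \<phi> (c e))"

text \<open>
  The chain group generated by the image; lemma \<open>image_chain_group_eq\<close> below describes it by
  linear combinations.
\<close>

definition image_chain_group ::
  "('b, 'n) ring_scheme \<Rightarrow> 'e set \<Rightarrow> ('a \<Rightarrow> 'b) \<Rightarrow> ('e \<Rightarrow> 'a) set \<Rightarrow> ('e \<Rightarrow> 'b) set" where
  "image_chain_group R' E \<phi> C = chain_group R' E hull (image_chain E \<phi> ` C)"


section \<open>The generated chain group as a set of linear combinations\<close>

lemma (in ring) image_chain_group_eq:
  assumes img: "\<And>c. c \<in> C \<Longrightarrow> image_chain E \<phi> c \<in> E \<rightarrow>\<^sub>E carrier R"
  shows "image_chain_group R E \<phi> C =
    {\<lambda>e\<in>E. \<Oplus>i\<in>{..<n}. r i \<otimes> \<phi> (c i e) | n r c.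
       r \<in> {..<n::nat} \<rightarrow> carrier R \<and> c \<in> {..<n} \<rightarrow> C}" (is "_ = ?L")
proof -
  have phi: "\<phi> (c e) \<in> carrier R" if "c \<in> C" "e \<in> E" for c e
    using img[OF that(1)] that(2) unfolding image_chain_def
    by (metis PiE_mem restrict_apply')
  have mem: "(\<lambda>e\<in>E. \<Oplus>i\<in>{..<n}. r i \<otimes> \<phi> (c i e)) \<in> ?L"
    if "r \<in> {..<n::nat} \<rightarrow> carrier R" "c \<in> {..<n} \<rightarrow> C" for n r c
    using that by blast
  have cg: "chain_group R E ?L"
    unfolding chain_group_def
  proof (intro conjI ballI)
    show "?L \<subseteq> E \<rightarrow>\<^sub>E carrier R"
      by (auto intro!: finsum_closed m_closed phi)
    show "zero_chain R E \<in> ?L"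
      using mem[of "\<lambda>_. \<zero>" 0 "\<lambda>_. undefined"] by (simp add: zero_chain_def)
  next
    fix x y assume "x \<in> ?L" "y \<in> ?L"
    then obtain n r c n' r' c' where
      x: "x = (\<lambda>e\<in>E. \<Oplus>i\<in>{..<n}. r i \<otimes> \<phi> (c i e))"
         "r \<in> {..<n::nat} \<rightarrow> carrier R" "c \<in> {..<n} \<rightarrow> C" and
      y: "y = (\<lambda>e\<in>E. \<Oplus>i\<in>{..<n'}. r' i \<otimes> \<phi> (c' i e))"
         "r' \<in> {..<n'::nat} \<rightarrow> carrier R" "c' \<in> {..<n'} \<rightarrow> C"
      by blast
    define r2 where "r2 i = (if i < n then r i else r' (i - n))" for i
    define c2 where "c2 i = (if i < n then c i else c' (i - n))" for i
    have r2: "r2 \<in> {..<n+n'} \<rightarrow> carrier R" using x(2) y(2) by (auto simp: r2_def Pi_iff)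
    have c2: "c2 \<in> {..<n+n'} \<rightarrow> C" using x(3) y(3) by (auto simp: c2_def Pi_iff)
    have "(\<Oplus>i\<in>{..<n+n'}. r2 i \<otimes> \<phi> (c2 i e)) =
          (\<Oplus>i\<in>{..<n}. r i \<otimes> \<phi> (c i e)) \<oplus> (\<Oplus>i\<in>{..<n'}. r' i \<otimes> \<phi> (c' i e))"
      if e: "e \<in> E" for e
    proof -
      have split: "{..<n+n'} = {..<n} \<union> (\<lambda>i. n + i) ` {..<n'}"
      proof (intro Set.set_eqI iffI)
        fix i assume "i \<in> {..<n+n'}"
        then show "i \<in> {..<n} \<union> (\<lambda>i. n + i) ` {..<n'}"
          by (cases "i < n") (auto intro!: image_eqI[of _ _ "i - n"])
      qed auto
      have cl: "r2 i \<otimes> \<phi> (c2 i e) \<in> carrier R" if "i < n + n'" for i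
        using r2 c2 that phi[OF _ e] by (auto simp: Pi_iff)
      have "(\<Oplus>i\<in>{..<n+n'}. r2 i \<otimes> \<phi> (c2 i e)) =
            (\<Oplus>i\<in>{..<n}. r2 i \<otimes> \<phi> (c2 i e)) \<oplus>
            (\<Oplus>i\<in>(\<lambda>i. n + i) ` {..<n'}. r2 i \<otimes> \<phi> (c2 i e))"
        unfolding split using cl by (intro finsum_Un_disjoint) auto
      also have "(\<Oplus>i\<in>(\<lambda>i. n + i) ` {..<n'}. r2 i \<otimes> \<phi> (c2 i e)) =
                 (\<Oplus>i\<in>{..<n'}. r2 (n + i) \<otimes> \<phi> (c2 (n + i) e))"
        using cl by (intro finsum_reindex) auto
      also have "\<dots> = (\<Oplus>i\<in>{..<n'}. r' i \<otimes> \<phi> (c' i e))"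
        by (simp add: r2_def c2_def)
      also have "(\<Oplus>i\<in>{..<n}. r2 i \<otimes> \<phi> (c2 i e)) = (\<Oplus>i\<in>{..<n}. r i \<otimes> \<phi> (c i e))"
        using x(2,3) phi[OF _ e]
        by (intro finsum_cong') (auto simp: r2_def c2_def Pi_iff)
      finally show ?thesis .
    qed
    then have "add_chain R E x y = (\<lambda>e\<in>E. \<Oplus>i\<in>{..<n+n'}. r2 i \<otimes> \<phi> (c2 i e))"
      by (auto simp: add_chain_def x y restrict_def)
    with mem[OF r2 c2] show "add_chain R E x y \<in> ?L" by simp
  next
    fix s x assume s: "s \<in> carrier R" and "x \<in> ?L"
    then obtain n r c where
      x: "x = (\<lambda>e\<in>E. \<Oplus>i\<in>{..<n}. r i \<otimes> \<phi> (c i e))"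
         "r \<in> {..<n::nat} \<rightarrow> carrier R" "c \<in> {..<n} \<rightarrow> C"
      by blast
    have sr: "(\<lambda>i. s \<otimes> r i) \<in> {..<n} \<rightarrow> carrier R" using s x by auto
    have "s \<otimes> (\<Oplus>i\<in>{..<n}. r i \<otimes> \<phi> (c i e)) = (\<Oplus>i\<in>{..<n}. (s \<otimes> r i) \<otimes> \<phi> (c i e))"
      if e: "e \<in> E" for e
    proof -
      have cl: "\<phi> (c i e) \<in> carrier R" "r i \<in> carrier R" if "i < n" for i
        using that x phi e by auto
      have "s \<otimes> (\<Oplus>i\<in>{..<n}. r i \<otimes> \<phi> (c i e)) = (\<Oplus>i\<in>{..<n}. s \<otimes> (r i \<otimes> \<phi> (c i e)))"
        using s cl by (intro finsum_rdistr) auto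
      also have "\<dots> = (\<Oplus>i\<in>{..<n}. (s \<otimes> r i) \<otimes> \<phi> (c i e))"
        using s cl by (intro finsum_cong') (auto simp: m_assoc)
      finally show ?thesis .
    qed
    then have "scale_chain R E s x = (\<lambda>e\<in>E. \<Oplus>i\<in>{..<n}. (s \<otimes> r i) \<otimes> \<phi> (c i e))"
      by (auto simp: scale_chain_def x restrict_def)
    with mem[OF sr x(3)] show "scale_chain R E s x \<in> ?L" by simp
  qed
  have sub: "image_chain E \<phi> ` C \<subseteq> ?L"
  proof
    fix x assume "x \<in> image_chain E \<phi> ` C"
    then obtain c where c: "c \<in> C" "x = image_chain E \<phi> c" by blast
    have "x = (\<lambda>e\<in>E. \<Oplus>i\<in>{..<1::nat}. (\<lambda>_. \<one>) i \<otimes> \<phi> ((\<lambda>_. c) i e))"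
      using c phi by (auto simp: image_chain_def restrict_def lessThan_Suc)
    with mem[of "\<lambda>_. \<one>" 1 "\<lambda>_. c"] c show "x \<in> ?L" by simp
  qed
  have least: "?L \<subseteq> D" if D: "chain_group R E D" and CD: "image_chain E \<phi> ` C \<subseteq> D" for D
  proof -
    have "(\<lambda>e\<in>E. \<Oplus>i\<in>{..<n}. r i \<otimes> \<phi> (c i e)) \<in> D"
      if "r \<in> {..<n::nat} \<rightarrow> carrier R" "c \<in> {..<n} \<rightarrow> C" for n r c
      using that
    proof (induction n)
      case 0
      then show ?case using D by (simp add: chain_group_def zero_chain_def restrict_def)
    next
      case (Suc n)
      have cl: "\<phi> (c i e) \<in> carrier R" "r i \<in> carrier R" if "i < Suc n" "e \<in> E" for i e
        using that Suc.prems phi by auto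
      have IH: "(\<lambda>e\<in>E. \<Oplus>i\<in>{..<n}. r i \<otimes> \<phi> (c i e)) \<in> D"
        using Suc.prems by (intro Suc.IH) auto
      have "scale_chain R E (r n) (image_chain E \<phi> (c n)) \<in> D"
      proof -
        have "r n \<in> carrier R" "image_chain E \<phi> (c n) \<in> D" using CD Suc.prems by auto
        then show ?thesis using D by (simp add: chain_group_def)
      qed
      from this IH have "add_chain R E (scale_chain R E (r n) (image_chain E \<phi> (c n)))
             (\<lambda>e\<in>E. \<Oplus>i\<in>{..<n}. r i \<otimes> \<phi> (c i e)) \<in> D"
        using D by (auto simp: chain_group_def)
      also have "add_chain R E (scale_chain R E (r n) (image_chain E \<phi> (c n)))
             (\<lambda>e\<in>E. \<Oplus>i\<in>{..<n}. r i \<otimes> \<phi> (c i e)) =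
             (\<lambda>e\<in>E. \<Oplus>i\<in>{..<Suc n}. r i \<otimes> \<phi> (c i e))"
      proof -
        have "(\<Oplus>i\<in>{..<Suc n}. r i \<otimes> \<phi> (c i e)) =
              r n \<otimes> \<phi> (c n e) \<oplus> (\<Oplus>i\<in>{..<n}. r i \<otimes> \<phi> (c i e))" if "e \<in> E" for e
          unfolding lessThan_Suc using cl that by (intro finsum_insert) auto
        then show ?thesis
          unfolding add_chain_def scale_chain_def image_chain_def
          by (intro restrict_ext) simp
      qed
      finally show ?case .
    qed
    then show ?thesis by blast
  qed
  show ?thesis
    unfolding image_chain_group_def
  proof (rule equalityI)
    show "chain_group R E hull (image_chain E \<phi> ` C) \<subseteq> ?L"
      using sub cg by (rule hull_minimal)
    show "?L \<subseteq> chain_group R E hull (image_chain E \<phi> ` C)"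
      unfolding hull_def by (rule Inter_greatest) (use least in simp)
  qed
qed


section \<open>Existence and uniqueness of the matroid of a chain group\<close>

definition indep_system :: "'e matroid \<Rightarrow> bool" where
  "indep_system M \<longleftrightarrow>
     finite (ground M) \<and> indep M \<subseteq> Pow (ground M) \<and> {} \<in> indep M \<and>
     (\<forall>I\<in>indep M. \<forall>J. J \<subseteq> I \<longrightarrow> J \<in> indep M)"

lemma is_matroid_indep_system: "is_matroid M \<Longrightarrow> indep_system M"
  by (simp add: is_matroid_def indep_system_def)

lemma indep_in_basis:
  assumes "indep_system M" "I \<in> indep M"
  obtains B where "B \<in> bases M" "I \<subseteq> B"
proof -
  have "finite (indep M)"
    using assms unfolding indep_system_def by (meson finite_Pow_iff finite_subset)
  from finite_has_maximal2[OF this assms(2)]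
  obtain B where "B \<in> indep M" "I \<subseteq> B" "\<forall>J\<in>indep M. B \<subseteq> J \<longrightarrow> B = J" by blast
  then show thesis by (intro that[of B]) (auto simp: bases_def)
qed

lemma indep_iff_basis:
  assumes "indep_system M"
  shows "I \<in> indep M \<longleftrightarrow> (\<exists>B\<in>bases M. I \<subseteq> B)"
  using assms indep_in_basis[OF assms]
  unfolding indep_system_def by (metis (no_types, lifting) bases_def mem_Collect_eq)

lemma bases_sub_ground: "indep_system M \<Longrightarrow> B \<in> bases M \<Longrightarrow> B \<subseteq> ground M"
  unfolding indep_system_def bases_def by blast

lemma ground_dual [simp]: "ground (dual M) = ground M"
  by (simp add: dual_def)

lemma indep_dual: "indep (dual M) = {I. I \<subseteq> ground M \<and> (\<exists>B\<in>bases M. I \<inter> B = {})}"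
  by (simp add: dual_def)

lemma indep_system_dual:
  assumes "indep_system M" shows "indep_system (dual M)"
proof -
  obtain B where "B \<in> bases M"
    using indep_in_basis[OF assms] assms unfolding indep_system_def by metis
  moreover have "finite (ground M)" using assms by (simp add: indep_system_def)
  moreover have "J \<in> indep (dual M)" if "I \<in> indep (dual M)" "J \<subseteq> I" for I J
    using that unfolding indep_dual by blast
  moreover have "{} \<in> indep (dual M)" using \<open>B \<in> bases M\<close> by (auto simp: indep_dual)
  moreover have "indep (dual M) \<subseteq> Pow (ground M)" by (auto simp: indep_dual)
  ultimately show ?thesis by (simp add: indep_system_def)
qed

lemma bases_dual:
  assumes M: "indep_system M"
  shows "bases (dual M) = (\<lambda>B. ground M - B) ` bases M"
proof (intro equalityI subsetI)
  fix X assume "X \<in> bases (dual M)"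
  then have X: "X \<in> indep (dual M)" and mx: "\<And>I. I \<in> indep (dual M) \<Longrightarrow> X \<subseteq> I \<Longrightarrow> I = X"
    by (auto simp: bases_def)
  from X obtain B where B: "B \<in> bases M" "X \<inter> B = {}" "X \<subseteq> ground M"
    by (auto simp: indep_dual)
  have "ground M - B \<in> indep (dual M)" using B by (auto simp: indep_dual)
  from mx[OF this] B have "X = ground M - B" by blast
  with B show "X \<in> (\<lambda>B. ground M - B) ` bases M" by blast
next
  fix X assume "X \<in> (\<lambda>B. ground M - B) ` bases M"
  then obtain B where B: "B \<in> bases M" "X = ground M - B" by blast
  have "I = X" if I: "I \<in> indep (dual M)" "X \<subseteq> I" for I
  proof -
    from I obtain B' where B': "B' \<in> bases M" "I \<inter> B' = {}" "I \<subseteq> ground M"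
      by (auto simp: indep_dual)
    have "B' \<subseteq> B" using B B' I bases_sub_ground[OF M, of B'] by blast
    with B B' have "B' = B" by (auto simp: bases_def)
    with B B' I show ?thesis by blast
  qed
  moreover have "X \<in> indep (dual M)" using B by (auto simp: indep_dual)
  ultimately show "X \<in> bases (dual M)" by (auto simp: bases_def)
qed

lemma dual_dual:
  assumes M: "indep_system (M :: 'e matroid)"
  shows "dual (dual M) = M"
proof -
  have "I \<subseteq> ground M \<and> (\<exists>B\<in>bases M. I \<inter> (ground M - B) = {}) \<longleftrightarrow> (\<exists>B\<in>bases M. I \<subseteq> B)" for I
    using bases_sub_ground[OF M] by blast
  then have "indep (dual (dual M)) = indep M"
    by - (rule Set.set_eqI, simp add: indep_dual bases_dual[OF M] indep_iff_basis[OF M])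
  then show ?thesis by (simp add: matroid.equality)
qed

lemma bases_card:
  assumes "is_matroid M" "B \<in> bases M" "I \<in> indep M"
  shows "card I \<le> card B"
proof (rule ccontr)
  assume "\<not> ?thesis"
  then obtain e where "e \<in> I - B" "insert e B \<in> indep M"
    using assms unfolding is_matroid_def bases_def by (metis (no_types, lifting) linorder_not_le mem_Collect_eq)
  then show False using assms(2) by (auto simp: bases_def)
qed

lemma basis_between:
  assumes M: "is_matroid M" and I: "I \<in> indep M" and B: "B \<in> bases M"
  obtains B' where "B' \<in> bases M" "I \<subseteq> B'" "B' \<subseteq> I \<union> B"
proof -
  let ?S = "{J \<in> indep M. J \<subseteq> I \<union> B}"
  have fin: "finite ?S"
  proof (rule finite_subset)
    have "indep M \<subseteq> Pow (ground M)" using M by (simp add: is_matroid_def)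
    then show "?S \<subseteq> Pow (ground M)" by blast
    show "finite (Pow (ground M))" using M by (simp add: is_matroid_def)
  qed
  have "I \<in> ?S" using I by blast
  from finite_has_maximal2[OF fin this]
  obtain J where J: "J \<in> ?S" "I \<subseteq> J" and mx: "\<forall>K\<in>?S. J \<subseteq> K \<longrightarrow> J = K" by (elim bexE conjE)
  have Bi: "B \<in> indep M" using B by (simp add: bases_def)
  have "card B \<le> card J"
  proof (rule ccontr)
    assume "\<not> ?thesis"
    with J Bi M obtain e where e: "e \<in> B - J" "insert e J \<in> indep M"
      unfolding is_matroid_def by (metis (no_types, lifting) linorder_not_le mem_Collect_eq)
    then have "insert e J \<in> ?S" using J by auto
    from mx[rule_format, OF this] e show False by blast
  qed
  have "J \<in> bases M"
  proof -
    have "K = J" if K: "K \<in> indep M" "J \<subseteq> K" for K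
    proof -
      have "card K \<le> card J" using bases_card[OF M B K(1)] \<open>card B \<le> card J\<close> by simp
      moreover have "finite K" using K M unfolding is_matroid_def by (meson PowD finite_subset in_mono)
      ultimately show ?thesis using K(2) card_seteq by blast
    qed
    then show ?thesis using J by (auto simp: bases_def)
  qed
  then show thesis using J by (intro that) auto
qed

lemma is_matroid_dual:
  assumes M: "is_matroid M" shows "is_matroid (dual M)"
proof -
  have S: "indep_system (dual M)" by (rule indep_system_dual[OF is_matroid_indep_system[OF M]])
  have "\<exists>e\<in>J - I. insert e I \<in> indep (dual M)"
    if I: "I \<in> indep (dual M)" and J: "J \<in> indep (dual M)" and less: "card I < card J" for I J
  proof -
    from I obtain BI where BI: "BI \<in> bases M" "I \<inter> BI = {}" and Ig: "I \<subseteq> ground M"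
      by (auto simp: indep_dual)
    from J obtain BJ where BJ: "BJ \<in> bases M" "J \<inter> BJ = {}" and Jg: "J \<subseteq> ground M"
      by (auto simp: indep_dual)
    have fg: "finite (ground M)" using M by (simp add: is_matroid_def)
    have fin: "finite I" "finite J" using Ig Jg fg finite_subset by blast+
    have BJg: "BJ \<subseteq> ground M" using bases_sub_ground[OF is_matroid_indep_system[OF M] BJ(1)] .
    have "BJ - I \<in> indep M" using BJ M unfolding is_matroid_def bases_def by blast
    from basis_between[OF M this BI(1)]
    obtain B where B: "B \<in> bases M" "BJ - I \<subseteq> B" "B \<subseteq> (BJ - I) \<union> BI" .
    have BI0: "I \<inter> B = {}" using B BI by blast
    have finB: "finite B" "finite BJ"
      using fg BJg finite_subset bases_sub_ground[OF is_matroid_indep_system[OF M] B(1)] by blast+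
    have "\<not> J - I \<subseteq> B"
    proof
      assume sub: "J - I \<subseteq> B"
      have "card (BJ - I) + card (J - I) = card ((BJ - I) \<union> (J - I))"
        using BJ finB fin by (subst card_Un_disjoint) auto
      also have "\<dots> \<le> card B" using sub B finB by (intro card_mono) auto
      also have "\<dots> \<le> card BJ" using bases_card[OF M BJ(1)] B by (auto simp: bases_def)
      also have "\<dots> \<le> card ((BJ - I) \<union> (I - J))"
        using BJ finB fin by (intro card_mono) auto
      also have "\<dots> \<le> card (BJ - I) + card (I - J)" by (rule card_Un_le)
      finally have "card (J - I) \<le> card (I - J)" by simp
      moreover have "card I = card (I \<inter> J) + card (I - J)"
        using fin by (metis Int_Diff_Un Int_Diff_disjoint card_Un_disjoint finite_Diff finite_Int)
      moreover have "card J = card (I \<inter> J) + card (J - I)"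
        using fin by (metis Int_Diff_Un Int_Diff_disjoint Int_commute card_Un_disjoint finite_Diff finite_Int)
      ultimately show False using less by simp
    qed
    then obtain e where e: "e \<in> J - I" "e \<notin> B" by blast
    then have "insert e I \<in> indep (dual M)"
      using B BI0 Ig Jg unfolding indep_dual by blast
    with e show ?thesis by blast
  qed
  then show ?thesis using S by (simp add: is_matroid_def indep_system_def)
qed

lemma dependent_circuit:
  assumes fin: "finite (ground M)" and X: "X \<subseteq> ground M" "X \<notin> indep M"
  obtains Y where "Y \<in> circuits M" "Y \<subseteq> X"
proof -
  let ?S = "{Y \<in> Pow (ground M). Y \<notin> indep M}"
  have "finite ?S" "X \<in> ?S" using fin X by auto
  from finite_has_minimal2[OF this]
  obtain Y where Y: "Y \<in> ?S" "Y \<subseteq> X" "\<forall>Z\<in>?S. Z \<subseteq> Y \<longrightarrow> Y = Z" by blast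
  then have "Y \<in> circuits M" by (auto simp: circuits_def)
  with Y that show thesis by blast
qed

lemma matroid_eqI_circuits:
  assumes M: "indep_system (M :: 'e matroid)" and N: "indep_system N"
    and g: "ground M = ground N" and c: "circuits M = circuits N"
  shows "M = N"
proof -
  have *: "I \<in> indep K \<longleftrightarrow> I \<subseteq> ground K \<and> \<not> (\<exists>X\<in>circuits K. X \<subseteq> I)" if K: "indep_system K"
    for K :: "'e matroid" and I
  proof
    assume I: "I \<in> indep K"
    then have "X \<in> indep K" if "X \<subseteq> I" for X
      using K that by (simp add: indep_system_def)
    moreover have "I \<subseteq> ground K" using I K by (auto simp: indep_system_def)
    ultimately show "I \<subseteq> ground K \<and> \<not> (\<exists>X\<in>circuits K. X \<subseteq> I)"
      by (auto simp: circuits_def)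
  next
    assume "I \<subseteq> ground K \<and> \<not> (\<exists>X\<in>circuits K. X \<subseteq> I)"
    moreover have "finite (ground K)" using K by (simp add: indep_system_def)
    ultimately show "I \<in> indep K" using dependent_circuit by metis
  qed
  have "indep M = indep N" using *[OF M] *[OF N] g c by auto
  with g show ?thesis by (simp add: matroid.equality)
qed

lemma matroid_eqI_cocircuits:
  assumes "is_matroid (M :: 'e matroid)" "is_matroid N" "ground M = ground N"
    "cocircuits M = cocircuits N"
  shows "M = N"
proof -
  have "dual M = dual N"
    using assms unfolding cocircuits_def
    by (intro matroid_eqI_circuits indep_system_dual is_matroid_indep_system) auto
  then show ?thesis using assms by (metis dual_dual is_matroid_indep_system)
qed

lemma matroid_from_circuits:
  fixes E :: "'e set" and K :: "'e set set"
  assumes fin: "finite E" and KE: "K \<subseteq> Pow E" and ne: "{} \<notin> K"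
    and anti: "\<And>X Y. X \<in> K \<Longrightarrow> Y \<in> K \<Longrightarrow> X \<subseteq> Y \<Longrightarrow> X = Y"
    and elim: "\<And>X Y e. X \<in> K \<Longrightarrow> Y \<in> K \<Longrightarrow> X \<noteq> Y \<Longrightarrow> e \<in> X \<inter> Y \<Longrightarrow>
                 \<exists>Z\<in>K. Z \<subseteq> (X \<union> Y) - {e}"
  obtains M where "is_matroid M" "ground M = E" "circuits M = K"
proof -
  define ind where "ind = {I. I \<subseteq> E \<and> \<not> (\<exists>X\<in>K. X \<subseteq> I)}"
  define M where "M = \<lparr>ground = E, indep = ind\<rparr>"
  have her: "J \<in> ind" if "I \<in> ind" "J \<subseteq> I" for I J using that unfolding ind_def by blast
  have aug: "\<exists>e\<in>J - I. insert e I \<in> ind"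
    if I: "I \<in> ind" and J: "J \<in> ind" and less: "card I < card J" for I J
  proof (rule ccontr)
    assume contra: "\<not> ?thesis"
    have IJE: "I \<subseteq> E" "J \<subseteq> E" using I J by (auto simp: ind_def)
    then have finIJ: "finite I" "finite J" using fin finite_subset by blast+
    have "\<exists>L. L \<in> ind \<and> L \<subseteq> I \<union> J \<and> card I < card L" using J less by blast
    then obtain L where L: "L \<in> ind" "L \<subseteq> I \<union> J" "card I < card L"
      and mn: "\<And>L'. L' \<in> ind \<Longrightarrow> L' \<subseteq> I \<union> J \<Longrightarrow> card I < card L' \<Longrightarrow> card (I - L) \<le> card (I - L')"
      using ex_has_least_nat[of "\<lambda>L. L \<in> ind \<and> L \<subseteq> I \<union> J \<and> card I < card L" _ "\<lambda>L. card (I - L)"]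
      by metis
    have finL: "finite L" using L finIJ finite_subset by blast
    have LI: "L - I \<noteq> {}"
    proof
      assume "L - I = {}"
      then have "card L \<le> card I" using finIJ by (intro card_mono) auto
      with L show False by simp
    qed
    have "\<not> I \<subseteq> L"
    proof
      assume sub: "I \<subseteq> L"
      from LI obtain e where e: "e \<in> L - I" by blast
      then have "insert e I \<in> ind" using her[OF L(1)] sub by simp
      moreover have "e \<in> J - I" using e L by blast
      ultimately show False using contra by blast
    qed
    then obtain e where e: "e \<in> I - L" by blast
    have circ: "\<exists>X\<in>K. X \<subseteq> insert e L - {f} \<and> e \<in> X" if f: "f \<in> L - I" for f
    proof -
      let ?T = "insert e L - {f}"
      have "card ?T = card L" using e f finL
        by (metis DiffD1 DiffD2 card_Suc_Diff1 card_insert_disjoint finite_insert insertI2 nat.inject)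
      moreover have "?T \<subseteq> I \<union> J" using e L by blast
      moreover have "card (I - ?T) < card (I - L)"
        using e f finIJ by (intro psubset_card_mono) auto
      ultimately have "?T \<notin> ind" using mn[of ?T] L by fastforce
      moreover have "?T \<subseteq> E" using \<open>?T \<subseteq> I \<union> J\<close> IJE by blast
      ultimately obtain X where X: "X \<in> K" "X \<subseteq> ?T" by (auto simp: ind_def)
      have "e \<in> X"
      proof (rule ccontr)
        assume "e \<notin> X"
        then have "X \<subseteq> L" using X by blast
        then show False using X L by (auto simp: ind_def)
      qed
      with X show ?thesis by blast
    qed
    from LI obtain g where g: "g \<in> L - I" by blast
    from circ[OF g] obtain Xg where Xg: "Xg \<in> K" "Xg \<subseteq> insert e L - {g}" "e \<in> Xg" by blast
    have "\<not> Xg \<subseteq> I" using Xg I by (auto simp: ind_def)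
    then obtain h where h: "h \<in> Xg" "h \<notin> I" by blast
    then have hL: "h \<in> L - I" using Xg e by blast
    from circ[OF hL] obtain Xh where Xh: "Xh \<in> K" "Xh \<subseteq> insert e L - {h}" "e \<in> Xh" by blast
    have "Xg \<noteq> Xh" using h Xh by blast
    then obtain Z where Z: "Z \<in> K" "Z \<subseteq> (Xg \<union> Xh) - {e}"
      using elim[of Xg Xh e] Xg Xh by blast
    then have "Z \<subseteq> L" using Xg Xh by blast
    then show False using Z L by (auto simp: ind_def)
  qed
  have "is_matroid M"
    unfolding is_matroid_def
  proof (intro conjI ballI allI impI)
    show "finite (ground M)" using fin by (simp add: M_def)
    show "indep M \<subseteq> Pow (ground M)" by (auto simp: M_def ind_def)
    show "{} \<in> indep M" using ne by (auto simp: M_def ind_def)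
    show "J \<in> indep M" if "I \<in> indep M" "J \<subseteq> I" for I J
      using her[of I J] that by (simp add: M_def)
    show "\<exists>e\<in>J - I. insert e I \<in> indep M"
      if "I \<in> indep M" "J \<in> indep M" "card I < card J" for I J
      using aug[of I J] that by (simp add: M_def)
  qed
  moreover have "circuits M = K"
  proof (intro equalityI subsetI)
    fix X assume "X \<in> circuits M"
    then have X: "X \<subseteq> E" "X \<notin> ind" "\<And>Y. Y \<subset> X \<Longrightarrow> Y \<in> ind" by (auto simp: circuits_def M_def)
    then obtain Y where Y: "Y \<in> K" "Y \<subseteq> X" by (auto simp: ind_def)
    then have "Y \<notin> ind" by (auto simp: ind_def)
    with X(3) Y have "Y = X" by blast
    with Y show "X \<in> K" by simp
  next
    fix X assume X: "X \<in> K"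
    have "Y \<in> ind" if "Y \<subset> X" for Y
    proof -
      have "Y \<subseteq> E" using that X KE by blast
      moreover have "\<not> Z \<subseteq> Y" if "Z \<in> K" for Z
        using anti[OF that X] \<open>Y \<subset> X\<close> by blast
      ultimately show ?thesis by (auto simp: ind_def)
    qed
    then show "X \<in> circuits M" using X KE by (auto simp: circuits_def M_def ind_def)
  qed
  moreover have "ground M = E" by (simp add: M_def)
  ultimately show thesis using that by blast
qed

lemma chain_support_empty_iff:
  assumes "chain_group R E C" "c \<in> C"
  shows "chain_support R E c = {} \<longleftrightarrow> c = zero_chain R E"
proof
  have c: "c \<in> E \<rightarrow>\<^sub>E carrier R" using assms by (auto simp: chain_group_def)
  assume "chain_support R E c = {}"
  then show "c = zero_chain R E"
    using c by (intro ext) (auto simp: chain_support_def zero_chain_def restrict_def PiE_def extensional_def)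
qed (simp add: chain_support_def zero_chain_def)

lemma elementary_in_support:
  assumes fin: "finite E" and cg: "chain_group R E C"
    and c: "c \<in> C" "c \<noteq> zero_chain R E"
  obtains d where "elementary R E C d" "chain_support R E d \<subseteq> chain_support R E c"
proof -
  let ?S = "chain_support R E ` {d \<in> C. d \<noteq> zero_chain R E}"
  have "?S \<subseteq> Pow E" by (auto simp: chain_support_def)
  then have "finite ?S" using fin by (meson finite_Pow_iff finite_subset)
  moreover have "chain_support R E c \<in> ?S" using c by blast
  ultimately obtain X where X: "X \<in> ?S" "X \<subseteq> chain_support R E c" "\<forall>Y\<in>?S. Y \<subseteq> X \<longrightarrow> X = Y"
    using finite_has_minimal2[of ?S "chain_support R E c"] by blast
  then obtain d where d: "d \<in> C" "d \<noteq> zero_chain R E" "X = chain_support R E d" by blast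
  then have "elementary R E C d" unfolding elementary_def using X by blast
  with d X that show thesis by blast
qed

lemma elementary_primitive:
  assumes P: "skew_partial_field R G" and C: "pf_chain_group R G E C"
    and c: "elementary R E C c"
  obtains d where "elementary R E C d" "primitive R G E d" "chain_support R E d = chain_support R E c"
proof -
  interpret ring R using P by (simp add: skew_partial_field_def)
  have cg: "chain_group R E C" using C by (simp add: pf_chain_group_def)
  obtain r d where r: "r \<in> carrier R" and d: "d \<in> C" "primitive R G E d" "c = scale_chain R E r d"
    using C c unfolding pf_chain_group_def by blast
  have sub: "chain_support R E c \<subseteq> chain_support R E d"
    using r by (auto simp: d(3) chain_support_def scale_chain_def)
  have ne: "chain_support R E c \<noteq> {}"
    using c chain_support_empty_iff[OF cg] by (auto simp: elementary_def)
  have G: "G \<subseteq> Units R" using P subgroup.subset[of G "units_of R"]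
    by (auto simp: skew_partial_field_def units_of_def)
  have "chain_support R E d \<subseteq> chain_support R E c"
  proof
    fix e assume e: "e \<in> chain_support R E d"
    then have "d e \<in> Units R" using d(2) G by (auto simp: primitive_def chain_support_def)
    moreover have "r \<noteq> \<zero>\<^bsub>R\<^esub>"
    proof
      assume "r = \<zero>\<^bsub>R\<^esub>"
      have "d f \<in> carrier R" if "f \<in> E" for f using d(1) cg that by (auto simp: chain_group_def)
      with \<open>r = \<zero>\<^bsub>R\<^esub>\<close> have "chain_support R E c = {}"
        by (auto simp: d(3) chain_support_def scale_chain_def)
      with ne show False by simp
    qed
    ultimately have "r \<otimes>\<^bsub>R\<^esub> d e \<noteq> \<zero>\<^bsub>R\<^esub>"
      by (metis Units_closed Units_inv_closed Units_r_inv l_null m_assoc r r_one)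
    then show "e \<in> chain_support R E c"
      using e by (auto simp: d(3) chain_support_def scale_chain_def)
  qed
  with sub have eq: "chain_support R E d = chain_support R E c" by blast
  then have "d \<noteq> zero_chain R E" using ne chain_support_empty_iff[OF cg d(1)] by auto
  then have "elementary R E C d" using c d(1) eq by (simp add: elementary_def)
  with d eq that show thesis by blast
qed

lemma matroid_of_chain_group:
  assumes P: "skew_partial_field R G" and C: "pf_chain_group R G E C" and fin: "finite E"
  shows "is_matroid (matroid_of R E C)"
    and "ground (matroid_of R E C) = E"
    and "cocircuits (matroid_of R E C) = chain_support R E ` {c. elementary R E C c}"
    and "\<exists>!M. is_matroid M \<and> ground M = E \<and>
              cocircuits M = chain_support R E ` {c. elementary R E C c}"
proof -
  interpret ring R using P by (simp add: skew_partial_field_def)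
  have cg: "chain_group R E C" using C by (simp add: pf_chain_group_def)
  have G: "G \<subseteq> Units R" using P subgroup.subset[of G "units_of R"]
    by (auto simp: skew_partial_field_def units_of_def)
  let ?K = "chain_support R E ` {c. elementary R E C c}"
  have KE: "?K \<subseteq> Pow E" by (auto simp: chain_support_def)
  have ne: "{} \<notin> ?K"
    using chain_support_empty_iff[OF cg] by (auto simp: elementary_def)
  have anti: "X = Y" if "X \<in> ?K" "Y \<in> ?K" "X \<subseteq> Y" for X Y
    using that by (auto simp: elementary_def)
  have elim: "\<exists>Z\<in>?K. Z \<subseteq> (X \<union> Y) - {e}"
    if XY: "X \<in> ?K" "Y \<in> ?K" "X \<noteq> Y" and e: "e \<in> X \<inter> Y" for X Y e
  proof -
    obtain c where c: "elementary R E C c" "primitive R G E c" "X = chain_support R E c"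
      using XY(1) elementary_primitive[OF P C] by (smt (verit) image_iff mem_Collect_eq)
    obtain d where d: "elementary R E C d" "primitive R G E d" "Y = chain_support R E d"
      using XY(2) elementary_primitive[OF P C] by (smt (verit) image_iff mem_Collect_eq)
    have cC: "c \<in> C" "d \<in> C" using c d by (auto simp: elementary_def)
    have car: "c f \<in> carrier R" "d f \<in> carrier R" if "f \<in> E" for f
      using cC cg that by (auto simp: chain_group_def)
    have eE: "e \<in> E" using e c by (auto simp: chain_support_def)
    have de: "d e \<in> Units R"
      using e d G eE by (auto simp: primitive_def chain_support_def)
    define s where "s = \<ominus>\<^bsub>R\<^esub> (c e \<otimes>\<^bsub>R\<^esub> inv\<^bsub>R\<^esub> (d e))"
    have s: "s \<in> carrier R" using de car eE by (simp add: s_def)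
    define x where "x = add_chain R E c (scale_chain R E s d)"
    have xC: "x \<in> C" using cC s cg by (auto simp: x_def chain_group_def)
    have xf: "x f = c f \<oplus>\<^bsub>R\<^esub> s \<otimes>\<^bsub>R\<^esub> d f" if "f \<in> E" for f
      using that by (simp add: x_def add_chain_def scale_chain_def)
    have xe: "x e = \<zero>\<^bsub>R\<^esub>"
    proof -
      have "s \<otimes>\<^bsub>R\<^esub> d e = \<ominus>\<^bsub>R\<^esub> (c e \<otimes>\<^bsub>R\<^esub> inv\<^bsub>R\<^esub> (d e) \<otimes>\<^bsub>R\<^esub> d e)"
        using de car eE by (simp add: s_def l_minus)
      also have "\<dots> = \<ominus>\<^bsub>R\<^esub> (c e)"
        using de car eE by (simp add: m_assoc)
      finally show ?thesis using xf eE car by (simp add: r_neg)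
    qed
    have xsub: "chain_support R E x \<subseteq> (X \<union> Y) - {e}"
      using xe xf s car by (auto simp: c(3) d(3) chain_support_def)
    have "\<not> X \<subseteq> Y" using XY anti by blast
    then obtain f where f: "f \<in> X" "f \<notin> Y" by blast
    then have "f \<in> E" "c f \<noteq> \<zero>\<^bsub>R\<^esub>" "d f = \<zero>\<^bsub>R\<^esub>" by (auto simp: c(3) d(3) chain_support_def)
    then have "x f \<noteq> \<zero>\<^bsub>R\<^esub>" using xf s car by simp
    then have "x \<noteq> zero_chain R E" using \<open>f \<in> E\<close> by (auto simp: zero_chain_def)
    then obtain z where "elementary R E C z" "chain_support R E z \<subseteq> chain_support R E x"
      using elementary_in_support[OF fin cg xC] by blast
    with xsub show ?thesis by blast
  qed
  obtain N where N: "is_matroid N" "ground N = E" "circuits N = ?K"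
    using matroid_from_circuits[OF fin KE ne anti elim] .
  have M: "is_matroid (dual N) \<and> ground (dual N) = E \<and> cocircuits (dual N) = ?K"
    using N is_matroid_dual by (simp add: cocircuits_def dual_dual is_matroid_indep_system)
  show ex: "\<exists>!M. is_matroid M \<and> ground M = E \<and> cocircuits M = ?K"
  proof (rule ex1I[where a = "dual N"], rule M)
    fix L assume "is_matroid L \<and> ground L = E \<and> cocircuits L = ?K"
    with M show "L = dual N" by (intro matroid_eqI_cocircuits) simp_all
  qed
  from theI'[OF ex] show "is_matroid (matroid_of R E C)" "ground (matroid_of R E C) = E"
    "cocircuits (matroid_of R E C) = ?K"
    unfolding matroid_of_def by blast+
qed

end

theory Submission
  imports Defs "HOL-Algebra.Multiplicative_Group"
begin

text \<open>
  The key point is that every nonzero chain \<open>d\<close> of \<open>\<phi>(C)\<close> contains the support of an elementary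
  chain of \<open>C\<close>. Otherwise the complement of the support of \<open>d\<close> contains a basis \<open>B\<close> of \<open>M(C)\<close>. The
  fundamental chains \<open>a e\<close> with respect to \<open>B\<close>, scaled by units to be 1 at \<open>e\<close>, satisfy
  \<open>c = (\<Sum>e\<in>B. c e * a e)\<close> for all \<open>c\<close> in \<open>C\<close>, so \<open>d = (\<Sum>e\<in>B. d e * \<phi>(a e))\<close> for all \<open>d\<close> in \<open>\<phi>(C)\<close>,
  and \<open>d\<close> vanishes because it vanishes on \<open>B\<close>. As \<open>\<phi>\<close> maps units to units, it preserves the
  supports of primitive chains, and both claims follow by comparing minimal supports.
\<close>

section \<open>Chain groups, units and finite sums: basic facts\<close>

lemma chain_group_carrier:
  "chain_group R E C \<Longrightarrow> c \<in> C \<Longrightarrow> e \<in> E \<Longrightarrow> c e \<in> carrier R"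
  by (auto simp: chain_group_def)

lemma chain_group_add:
  "chain_group R E C \<Longrightarrow> c \<in> C \<Longrightarrow> d \<in> C \<Longrightarrow> add_chain R E c d \<in> C"
  by (simp add: chain_group_def)

lemma chain_group_scale:
  "chain_group R E C \<Longrightarrow> r \<in> carrier R \<Longrightarrow> c \<in> C \<Longrightarrow> scale_chain R E r c \<in> C"
  by (simp add: chain_group_def)

lemma chain_group_eq_zeroI:
  assumes "chain_group R E C" "c \<in> C" "\<And>e. e \<in> E \<Longrightarrow> c e = \<zero>\<^bsub>R\<^esub>"
  shows "c = zero_chain R E"
  using chain_support_empty_iff[OF assms(1,2)] assms(3) by (auto simp: chain_support_def)

lemma skew_partial_field_Units:
  assumes "skew_partial_field R G"
  shows "G \<subseteq> Units R"
  using assms subgroup.subset[of G "units_of R"]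
  by (auto simp: skew_partial_field_def units_of_def)

lemma (in ring) Units_nonzero:
  assumes "\<one> \<noteq> \<zero>" "u \<in> Units R"
  shows "u \<noteq> \<zero>"
  using assms by (metis Units_closed Units_inv_closed Units_r_inv l_null)

lemma (in ring_hom_ring) hom_finsum_ring:
  assumes "f \<in> A \<rightarrow> carrier R"
  shows "h (\<Oplus>i\<in>A. f i) = (\<Oplus>\<^bsub>S\<^esub>i\<in>A. h (f i))"
  \<comment> \<open>For infinite \<open>A\<close> both sums take the default value zero, and
    \<open>h\<close> maps zero to zero.\<close>
  using assms by (induction A rule: infinite_finite_induct) (auto simp: Pi_def)

section \<open>Fundamental chains of \<open>C\<close> and expansion along them\<close>

lemma (in ring) chain_group_lincomb:
  assumes cg: "chain_group R E C" and fin: "finite B"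
    and a: "\<And>e. e \<in> B \<Longrightarrow> a e \<in> C" and r: "\<And>e. e \<in> B \<Longrightarrow> r e \<in> carrier R"
  shows "(\<lambda>f\<in>E. \<Oplus>e\<in>B. r e \<otimes> a e f) \<in> C"
  using fin a r
proof (induction B rule: finite_induct)
  case empty
  then show ?case using cg by (simp add: chain_group_def zero_chain_def restrict_def)
next
  case (insert x B)
  have "add_chain R E (scale_chain R E (r x) (a x)) (\<lambda>f\<in>E. \<Oplus>e\<in>B. r e \<otimes> a e f) \<in> C"
    using insert.prems
    by (intro chain_group_add[OF cg] chain_group_scale[OF cg] insert.IH) simp_all
  also have "add_chain R E (scale_chain R E (r x) (a x)) (\<lambda>f\<in>E. \<Oplus>e\<in>B. r e \<otimes> a e f)
      = (\<lambda>f\<in>E. \<Oplus>e\<in>insert x B. r e \<otimes> a e f)"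
    unfolding add_chain_def scale_chain_def
  proof (intro restrict_ext)
    fix f assume f: "f \<in> E"
    then have "(\<Oplus>e\<in>insert x B. r e \<otimes> a e f) = r x \<otimes> a x f \<oplus> (\<Oplus>e\<in>B. r e \<otimes> a e f)"
      using insert chain_group_carrier[OF cg _ f] by (intro finsum_insert) auto
    then show "(\<lambda>e\<in>E. r x \<otimes> a x e) f \<oplus> (\<lambda>f\<in>E. \<Oplus>e\<in>B. r e \<otimes> a e f) f
        = (\<Oplus>e\<in>insert x B. r e \<otimes> a e f)"
      using f by simp
  qed
  finally show ?case .
qed

text \<open>On \<open>B\<close> the chains \<open>a e\<close> are coordinate vectors, so
  \<open>c\<close> and the combination \<open>s\<close> with coefficients \<open>c e\<close> agree
  there. Their difference is a chain of \<open>C\<close> that vanishes on \<open>B\<close>, and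
  \<open>sep\<close> makes it zero on all of \<open>E\<close>.\<close>

lemma (in ring) chain_expansion:
  assumes cg: "chain_group R E C" and fin: "finite B" and BE: "B \<subseteq> E"
    and sep: "\<And>c. c \<in> C \<Longrightarrow> \<forall>e\<in>B. c e = \<zero> \<Longrightarrow> c = zero_chain R E"
    and a: "\<And>e. e \<in> B \<Longrightarrow> a e \<in> C"
    and dia: "\<And>e f. e \<in> B \<Longrightarrow> f \<in> B \<Longrightarrow> a e f = (if e = f then \<one> else \<zero>)"
    and c: "c \<in> C" and f: "f \<in> E"
  shows "c f = (\<Oplus>e\<in>B. c e \<otimes> a e f)"
proof -
  have cc: "c e \<in> carrier R" if "e \<in> E" for e using chain_group_carrier[OF cg c that] .
  have ac: "a e g \<in> carrier R" if "e \<in> B" "g \<in> E" for e g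
    using chain_group_carrier[OF cg a] that by blast
  define s where "s = (\<lambda>f\<in>E. \<Oplus>e\<in>B. c e \<otimes> a e f)"
  have sC: "s \<in> C" unfolding s_def using fin a cc BE by (intro chain_group_lincomb[OF cg]) auto
  have sc: "s g \<in> carrier R" if "g \<in> E" for g using chain_group_carrier[OF cg sC that] .
  \<comment> \<open>Subtraction is addition after scaling by \<open>\<ominus> \<one>\<close>, so the
    difference stays in \<open>C\<close>.\<close>
  define x where "x = add_chain R E c (scale_chain R E (\<ominus> \<one>) s)"
  have xC: "x \<in> C" unfolding x_def using sC c by (intro chain_group_add[OF cg] chain_group_scale[OF cg]) auto
  have x: "x g = c g \<ominus> s g" if "g \<in> E" for g
    using that sc cc by (simp add: x_def add_chain_def scale_chain_def a_minus_def l_minus)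
  have "x g = \<zero>" if g: "g \<in> B" for g
  proof -
    \<comment> \<open>By \<open>dia\<close> only the summand with \<open>e = g\<close>
      survives.\<close>
    have "s g = (\<Oplus>e\<in>B. if g = e then c e else \<zero>)"
      using g BE cc dia by (auto simp: s_def intro!: finsum_cong')
    also have "\<dots> = c g" using g BE cc fin by (intro finsum_singleton) auto
    finally show ?thesis using x[of g] g BE cc by (auto simp: a_minus_def r_neg)
  qed
  then have "x = zero_chain R E" using sep xC by blast
  then have "c f \<ominus> s f = \<zero>" using x[OF f] f by (simp add: zero_chain_def)
  then have "c f = s f" using cc[OF f] sc[OF f] by simp
  then show ?thesis using f by (simp add: s_def)
qed

text \<open>The set \<open>B\<close> is a basis of the matroid of \<open>C\<close> inside the spanning set \<open>Z\<close>.\<close>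

lemma fundamental_chains:
  assumes P: "skew_partial_field R G" and C: "pf_chain_group R G E C" and fin: "finite E"
    and ZE: "Z \<subseteq> E"
    and meet: "\<And>c. elementary R E C c \<Longrightarrow> chain_support R E c \<inter> Z \<noteq> {}"
  obtains B a where "B \<subseteq> Z"
    "\<And>c. c \<in> C \<Longrightarrow> \<forall>e\<in>B. c e = \<zero>\<^bsub>R\<^esub> \<Longrightarrow> c = zero_chain R E"
    "\<And>e. e \<in> B \<Longrightarrow> a e \<in> C"
    "\<And>e f. e \<in> B \<Longrightarrow> f \<in> B \<Longrightarrow> a e f = (if e = f then \<one>\<^bsub>R\<^esub> else \<zero>\<^bsub>R\<^esub>)"
proof -
  interpret ring R using P by (simp add: skew_partial_field_def)
  have cg: "chain_group R E C" using C by (simp add: pf_chain_group_def)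
  \<comment> \<open>The sets meeting every cocircuit are the spanning sets of the matroid; a minimal
    one inside \<open>Z\<close> is therefore a basis.\<close>
  define T where "T = {B. B \<subseteq> Z \<and> (\<forall>c. elementary R E C c \<longrightarrow> chain_support R E c \<inter> B \<noteq> {})}"
  have "T \<subseteq> Pow Z" by (auto simp: T_def)
  then have "finite T" using finite_subset[OF ZE fin] by (simp add: finite_subset)
  moreover have "Z \<in> T" using meet by (simp add: T_def)
  ultimately obtain B where BT: "B \<in> T" and min: "\<And>Y. Y \<in> T \<Longrightarrow> Y \<subseteq> B \<Longrightarrow> B = Y"
    using finite_has_minimal2[of T Z] by metis
  have BZ: "B \<subseteq> Z" and B: "\<And>c. elementary R E C c \<Longrightarrow> chain_support R E c \<inter> B \<noteq> {}"
    using BT by (simp_all add: T_def)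
  have BE: "B \<subseteq> E" using BZ ZE by blast
  have "\<exists>x\<in>C. \<forall>f\<in>B. x f = (if e = f then \<one>\<^bsub>R\<^esub> else \<zero>\<^bsub>R\<^esub>)" if e: "e \<in> B" for e
  proof -
    \<comment> \<open>By minimality, some elementary support misses \<open>B - {e}\<close>. It still
      meets \<open>B\<close>, hence meets it exactly in \<open>e\<close>: this is the fundamental
      cocircuit of \<open>e\<close>.\<close>
    have "B - {e} \<notin> T" using min[of "B - {e}"] e by blast
    then obtain c where c: "elementary R E C c" "chain_support R E c \<inter> (B - {e}) = {}"
      using BZ unfolding T_def by blast
    obtain d where d: "elementary R E C d" "primitive R G E d"
      "chain_support R E d = chain_support R E c"
      using elementary_primitive[OF P C c(1)] .
    have dC: "d \<in> C" using d by (simp add: elementary_def)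
    have "chain_support R E d \<inter> B \<noteq> {}" using B d(1) .
    then have "e \<in> chain_support R E d" using c d by blast
    \<comment> \<open>Passing to a primitive chain makes the entry at \<open>e\<close> an element of
      \<open>G\<close>, hence a unit. Scaling from the left by its inverse normalizes that entry to
      one.\<close>
    then have u: "d e \<in> Units R"
      using d(2) skew_partial_field_Units[OF P] by (auto simp: primitive_def chain_support_def)
    have z: "d f = \<zero>\<^bsub>R\<^esub>" if "f \<in> B" "f \<noteq> e" for f
      using c d that BE by (auto simp: chain_support_def)
    show ?thesis
    proof
      show "scale_chain R E (inv\<^bsub>R\<^esub> d e) d \<in> C"
        using u dC by (intro chain_group_scale[OF cg]) auto
      show "\<forall>f\<in>B. scale_chain R E (inv\<^bsub>R\<^esub> d e) d f = (if e = f then \<one>\<^bsub>R\<^esub> else \<zero>\<^bsub>R\<^esub>)"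
        using u z BE by (auto simp: scale_chain_def)
    qed
  qed
  then obtain a where a: "\<And>e. e \<in> B \<Longrightarrow> a e \<in> C"
    "\<And>e f. e \<in> B \<Longrightarrow> f \<in> B \<Longrightarrow> a e f = (if e = f then \<one>\<^bsub>R\<^esub> else \<zero>\<^bsub>R\<^esub>)"
    by metis
  \<comment> \<open>The support of a nonzero chain contains that of an elementary one, which
    \<open>B\<close> meets.\<close>
  have sep: "c = zero_chain R E" if c: "c \<in> C" "\<forall>e\<in>B. c e = \<zero>\<^bsub>R\<^esub>" for c
  proof (rule ccontr)
    assume "c \<noteq> zero_chain R E"
    then obtain d where d: "elementary R E C d" "chain_support R E d \<subseteq> chain_support R E c"
      using elementary_in_support[OF fin cg c(1)] by blast
    then have "chain_support R E d \<inter> B \<noteq> {}" using B by blast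
    then obtain e where "e \<in> B" "e \<in> chain_support R E c" using d(2) by blast
    then show False using c(2) by (simp add: chain_support_def)
  qed
  from that[OF BZ sep a] show thesis by blast
qed

section \<open>The chain group generated by the image\<close>

lemma image_chain_group:
  assumes "ring R'" and "chain_group R E C" and "\<phi> \<in> ring_hom R R'"
  shows "chain_group R' E (image_chain_group R' E \<phi> C)"
    and "c \<in> C \<Longrightarrow> image_chain E \<phi> c \<in> image_chain_group R' E \<phi> C"
proof -
  interpret R': ring R' by fact
  \<comment> \<open>The hull is an intersection of chain groups. The group of all chains shows that
    this family is nonempty, so the intersection consists of chains instead of being the set of all
    functions.\<close>
  have full: "chain_group R' E (E \<rightarrow>\<^sub>E carrier R')"
    by (auto simp: chain_group_def zero_chain_def add_chain_def scale_chain_def)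
  have sub: "image_chain E \<phi> ` C \<subseteq> (E \<rightarrow>\<^sub>E carrier R')"
    using chain_group_carrier[OF assms(2)] ring_hom_closed[OF assms(3)]
    by (auto simp: image_chain_def)
  have "chain_group R' E (\<Inter>{D. chain_group R' E D \<and> image_chain E \<phi> ` C \<subseteq> D})"
    using full sub unfolding chain_group_def by auto
  then show "chain_group R' E (image_chain_group R' E \<phi> C)"
    by (simp add: image_chain_group_def hull_def)
  show "c \<in> C \<Longrightarrow> image_chain E \<phi> c \<in> image_chain_group R' E \<phi> C"
    unfolding image_chain_group_def by (rule hull_inc) simp
qed

text \<open>The identity is linear in \<open>d\<close>: its coefficients \<open>d e\<close> stand on
  the left, where the scalars act, so it survives left scaling even in a noncommutative ring. Hence
  the chains satisfying it form a chain group \<open>D\<close>. The images of chains of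
  \<open>C\<close> lie in \<open>D\<close>, by applying \<open>\<phi>\<close> to \<open>ex\<close>,
  and so does the group they generate.\<close>

lemma image_chain_expansion:
  assumes R: "ring R" and R': "ring R'" and cg: "chain_group R E C" and \<phi>: "\<phi> \<in> ring_hom R R'"
    and fin: "finite B" and BE: "B \<subseteq> E" and a: "\<And>e. e \<in> B \<Longrightarrow> a e \<in> C"
    and ex: "\<And>c f. c \<in> C \<Longrightarrow> f \<in> E \<Longrightarrow> c f = (\<Oplus>\<^bsub>R\<^esub>e\<in>B. c e \<otimes>\<^bsub>R\<^esub> a e f)"
    and d: "d \<in> image_chain_group R' E \<phi> C" and f: "f \<in> E"
  shows "d f = (\<Oplus>\<^bsub>R'\<^esub>e\<in>B. d e \<otimes>\<^bsub>R'\<^esub> \<phi> (a e f))"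
proof -
  interpret R: ring R by fact
  interpret R': ring R' by fact
  interpret h: ring_hom_ring R R' \<phi> by (intro ring_hom_ringI2 R R' \<phi>)
  have ac: "\<phi> (a e g) \<in> carrier R'" if "e \<in> B" "g \<in> E" for e g
    using that chain_group_carrier[OF cg a[of e]] by simp
  define D where "D = {d \<in> E \<rightarrow>\<^sub>E carrier R'. \<forall>f\<in>E. d f = (\<Oplus>\<^bsub>R'\<^esub>e\<in>B. d e \<otimes>\<^bsub>R'\<^esub> \<phi> (a e f))}"
  have D1: "d e \<in> carrier R'" if "d \<in> D" "e \<in> E" for d e
    using that unfolding D_def by (blast dest: PiE_mem)
  have D3: "d \<in> D" if "d \<in> E \<rightarrow>\<^sub>E carrier R'"
    "\<And>f. f \<in> E \<Longrightarrow> d f = (\<Oplus>\<^bsub>R'\<^esub>e\<in>B. d e \<otimes>\<^bsub>R'\<^esub> \<phi> (a e f))" for d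
    using that unfolding D_def by blast
  have D2: "d f = (\<Oplus>\<^bsub>R'\<^esub>e\<in>B. d e \<otimes>\<^bsub>R'\<^esub> \<phi> (a e f))" if "d \<in> D" "f \<in> E" for d f
    using that by (auto simp: D_def)
  have "chain_group R' E D"
    unfolding chain_group_def
  proof (intro conjI ballI)
    show "D \<subseteq> E \<rightarrow>\<^sub>E carrier R'" by (auto simp: D_def)
    have "(\<Oplus>\<^bsub>R'\<^esub>e\<in>B. zero_chain R' E e \<otimes>\<^bsub>R'\<^esub> \<phi> (a e f)) = \<zero>\<^bsub>R'\<^esub>" if "f \<in> E" for f
      using that BE ac by (intro R'.add.finprod_one_eqI) (auto simp: zero_chain_def)
    then show "zero_chain R' E \<in> D" by (intro D3) (auto simp: zero_chain_def)
  next
    fix x y assume x: "x \<in> D" and y: "y \<in> D"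
    have "add_chain R' E x y f = (\<Oplus>\<^bsub>R'\<^esub>e\<in>B. add_chain R' E x y e \<otimes>\<^bsub>R'\<^esub> \<phi> (a e f))"
      if f: "f \<in> E" for f
    proof -
      have "add_chain R' E x y f
          = (\<Oplus>\<^bsub>R'\<^esub>e\<in>B. x e \<otimes>\<^bsub>R'\<^esub> \<phi> (a e f)) \<oplus>\<^bsub>R'\<^esub> (\<Oplus>\<^bsub>R'\<^esub>e\<in>B. y e \<otimes>\<^bsub>R'\<^esub> \<phi> (a e f))"
        using D2[OF x f] D2[OF y f] f by (simp add: add_chain_def)
      also have "\<dots> = (\<Oplus>\<^bsub>R'\<^esub>e\<in>B. x e \<otimes>\<^bsub>R'\<^esub> \<phi> (a e f) \<oplus>\<^bsub>R'\<^esub> y e \<otimes>\<^bsub>R'\<^esub> \<phi> (a e f))"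
        using D1[OF x] D1[OF y] ac f BE by (intro R'.finsum_addf[symmetric]) auto
      also have "\<dots> = (\<Oplus>\<^bsub>R'\<^esub>e\<in>B. add_chain R' E x y e \<otimes>\<^bsub>R'\<^esub> \<phi> (a e f))"
        using D1[OF x] D1[OF y] ac f BE
        by (intro R'.finsum_cong') (auto simp: add_chain_def R'.l_distr subset_iff)
      finally show ?thesis .
    qed
    moreover have "add_chain R' E x y \<in> E \<rightarrow>\<^sub>E carrier R'"
      using D1[OF x] D1[OF y] by (auto simp: add_chain_def)
    ultimately show "add_chain R' E x y \<in> D" by (intro D3)
  next
    fix r x assume r: "r \<in> carrier R'" and x: "x \<in> D"
    have "scale_chain R' E r x f = (\<Oplus>\<^bsub>R'\<^esub>e\<in>B. scale_chain R' E r x e \<otimes>\<^bsub>R'\<^esub> \<phi> (a e f))"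
      if f: "f \<in> E" for f
    proof -
      have "scale_chain R' E r x f = r \<otimes>\<^bsub>R'\<^esub> (\<Oplus>\<^bsub>R'\<^esub>e\<in>B. x e \<otimes>\<^bsub>R'\<^esub> \<phi> (a e f))"
        using D2[OF x f] f by (simp add: scale_chain_def)
      also have "\<dots> = (\<Oplus>\<^bsub>R'\<^esub>e\<in>B. r \<otimes>\<^bsub>R'\<^esub> (x e \<otimes>\<^bsub>R'\<^esub> \<phi> (a e f)))"
        using D1[OF x] ac f BE r fin by (intro R'.finsum_rdistr) auto
      also have "\<dots> = (\<Oplus>\<^bsub>R'\<^esub>e\<in>B. scale_chain R' E r x e \<otimes>\<^bsub>R'\<^esub> \<phi> (a e f))"
        using D1[OF x] ac f BE r
        by (intro R'.finsum_cong') (auto simp: scale_chain_def R'.m_assoc subset_iff)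
      finally show ?thesis .
    qed
    moreover have "scale_chain R' E r x \<in> E \<rightarrow>\<^sub>E carrier R'"
      using D1[OF x] r by (auto simp: scale_chain_def)
    ultimately show "scale_chain R' E r x \<in> D" by (intro D3)
  qed
  moreover have "image_chain E \<phi> c \<in> D" if c: "c \<in> C" for c
  proof -
    have cc: "c e \<in> carrier R" if "e \<in> E" for e using chain_group_carrier[OF cg c that] .
    have "image_chain E \<phi> c f = (\<Oplus>\<^bsub>R'\<^esub>e\<in>B. image_chain E \<phi> c e \<otimes>\<^bsub>R'\<^esub> \<phi> (a e f))" if f: "f \<in> E" for f
    proof -
      have a1: "a e f \<in> carrier R" if "e \<in> B" for e using chain_group_carrier[OF cg a f] that .
      have "\<phi> (c f) = (\<Oplus>\<^bsub>R'\<^esub>e\<in>B. \<phi> (c e \<otimes>\<^bsub>R\<^esub> a e f))"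
        using ex[OF c f] cc a1 BE h.hom_finsum_ring[of "\<lambda>e. c e \<otimes>\<^bsub>R\<^esub> a e f" B]
        by (auto simp: subset_iff)
      also have "\<dots> = (\<Oplus>\<^bsub>R'\<^esub>e\<in>B. image_chain E \<phi> c e \<otimes>\<^bsub>R'\<^esub> \<phi> (a e f))"
        using cc a1 BE by (intro R'.finsum_cong') (auto simp: image_chain_def subset_iff)
      finally show ?thesis using f by (simp add: image_chain_def)
    qed
    moreover have "image_chain E \<phi> c \<in> E \<rightarrow>\<^sub>E carrier R'"
      using cc by (auto simp: image_chain_def)
    ultimately show ?thesis by (intro D3)
  qed
  ultimately have "image_chain_group R' E \<phi> C \<subseteq> D"
    unfolding image_chain_group_def by (intro hull_minimal) auto
  with d D2 f show ?thesis by blast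
qed

section \<open>Elementary supports in \<open>C\<close> and in the image group\<close>

lemma image_chain_support_contains_elementary:
  assumes P: "skew_partial_field R G" and fin: "finite E" and C: "pf_chain_group R G E C"
    and P': "skew_partial_field R' G'" and \<phi>: "\<phi> \<in> ring_hom R R'"
    and d: "d \<in> image_chain_group R' E \<phi> C" "d \<noteq> zero_chain R' E"
  obtains c where "elementary R E C c" "chain_support R E c \<subseteq> chain_support R' E d"
proof (rule ccontr)
  assume "\<not> thesis"
  \<comment> \<open>The negated goal of an \<open>obtains\<close> statement, read as: no elementary
    chain of \<open>C\<close> has its support inside that of \<open>d\<close>.\<close>
  then have no: "\<not> chain_support R E c \<subseteq> chain_support R' E d" if "elementary R E C c" for c
    using that \<open>\<And>c. elementary R E C c \<Longrightarrow> chain_support R E c \<subseteq> chain_support R' E d \<Longrightarrow> thesis\<close>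
    by blast
  interpret R: ring R using P by (simp add: skew_partial_field_def)
  interpret R': ring R' using P' by (simp add: skew_partial_field_def)
  have cg: "chain_group R E C" using C by (simp add: pf_chain_group_def)
  let ?Z = "E - chain_support R' E d"
  have "chain_support R E c \<inter> ?Z \<noteq> {}" if "elementary R E C c" for c
    using no[OF that] by (auto simp: chain_support_def)
  then obtain B a where B: "B \<subseteq> ?Z"
    "\<And>c. c \<in> C \<Longrightarrow> \<forall>e\<in>B. c e = \<zero>\<^bsub>R\<^esub> \<Longrightarrow> c = zero_chain R E"
    "\<And>e. e \<in> B \<Longrightarrow> a e \<in> C"
    "\<And>e f. e \<in> B \<Longrightarrow> f \<in> B \<Longrightarrow> a e f = (if e = f then \<one>\<^bsub>R\<^esub> else \<zero>\<^bsub>R\<^esub>)"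
    using fundamental_chains[OF P C fin, of ?Z] by blast
  have BE: "B \<subseteq> E" using B by blast
  have finB: "finite B" using BE fin finite_subset by blast
  have ex: "c f = (\<Oplus>\<^bsub>R\<^esub>e\<in>B. c e \<otimes>\<^bsub>R\<^esub> a e f)" if "c \<in> C" "f \<in> E" for c f
    using R.chain_expansion[OF cg finB BE B(2-4) that] .
  have "d f = \<zero>\<^bsub>R'\<^esub>" if f: "f \<in> E" for f
  proof -
    have "\<phi> (a e f) \<in> carrier R'" if "e \<in> B" for e
      using chain_group_carrier[OF cg B(3)[OF that] f] \<phi> by (simp add: ring_hom_closed)
    moreover have "d e = \<zero>\<^bsub>R'\<^esub>" if "e \<in> B" for e using that B(1) by (auto simp: chain_support_def)
    ultimately have "(\<Oplus>\<^bsub>R'\<^esub>e\<in>B. d e \<otimes>\<^bsub>R'\<^esub> \<phi> (a e f)) = \<zero>\<^bsub>R'\<^esub>"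
      by (intro R'.add.finprod_one_eqI) auto
    then show ?thesis
      using image_chain_expansion[OF R.ring_axioms R'.ring_axioms cg \<phi> finB BE B(3) ex d(1) f]
      by simp
  qed
  then have "d = zero_chain R' E"
    using chain_group_eq_zeroI[OF image_chain_group(1)[OF R'.ring_axioms cg \<phi>] d(1)] by blast
  with d show False by simp
qed

text \<open>In general \<open>\<phi>\<close> may send nonzero entries to zero and shrink a support.
  Entries in \<open>G\<close> are safe: their images lie in \<open>G'\<close>, so they are units,
  and units are nonzero because one differs from zero in \<open>R'\<close>.\<close>

lemma image_chain_primitive:
  assumes P: "skew_partial_field R G" and P': "skew_partial_field R' G'"
    and \<phi>: "\<phi> \<in> ring_hom R R'" and G: "\<phi> ` G \<subseteq> G'" and c: "primitive R G E c"
  shows "primitive R' G' E (image_chain E \<phi> c)"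
    and "chain_support R' E (image_chain E \<phi> c) = chain_support R E c"
proof -
  interpret R': ring R' using P' by (simp add: skew_partial_field_def)
  have R: "ring R" using P by (simp add: skew_partial_field_def)
  have z: "\<phi> \<zero>\<^bsub>R\<^esub> = \<zero>\<^bsub>R'\<^esub>" using ring_hom_zero[OF \<phi> R R'.ring_axioms] .
  show "primitive R' G' E (image_chain E \<phi> c)"
    using c G z unfolding primitive_def image_chain_def by fastforce
  have "\<phi> u \<noteq> \<zero>\<^bsub>R'\<^esub>" if "u \<in> G" for u
    using that G skew_partial_field_Units[OF P'] P' R'.Units_nonzero[of "\<phi> u"]
    by (auto simp: skew_partial_field_def)
  then show "chain_support R' E (image_chain E \<phi> c) = chain_support R E c"
    using c z by (auto simp: primitive_def image_chain_def chain_support_def)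
qed

theorem theorem3p22:
  fixes R :: "('a, 'm) ring_scheme" and G :: "'a set"
    and R' :: "('b, 'n) ring_scheme" and G' :: "'b set"
    and E :: "'e set" and C :: "('e \<Rightarrow> 'a) set" and \<phi> :: "'a \<Rightarrow> 'b"
  assumes "skew_partial_field R G"
    and "finite E"
    and "pf_chain_group R G E C"
    and "skew_partial_field R' G'"
    and "\<phi> \<in> ring_hom R R'"
    and "\<phi> ` G \<subseteq> G'"
  shows "pf_chain_group R' G' E (image_chain_group R' E \<phi> C)
    \<and> matroid_of R E C = matroid_of R' E (image_chain_group R' E \<phi> C)"
proof -
  note P = assms(1) and fin = assms(2) and C = assms(3) and P' = assms(4)
    and \<phi> = assms(5) and G = assms(6)
  interpret R': ring R' using P' by (simp add: skew_partial_field_def)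
  let ?D = "image_chain_group R' E \<phi> C"
  have cg: "chain_group R E C" using C by (simp add: pf_chain_group_def)
  note D = image_chain_group(1)[OF R'.ring_axioms cg \<phi>]
    and inD = image_chain_group(2)[OF R'.ring_axioms cg \<phi>]
  note prim = image_chain_primitive[OF P P' \<phi> G]
  \<comment> \<open>The elementary chain found below \<open>d\<close> is exchanged for a primitive
    one with the same support, whose image keeps that support.\<close>
  have below: "\<exists>c. elementary R E C c \<and> primitive R G E c \<and> chain_support R E c \<subseteq> chain_support R' E d"
    if "d \<in> ?D" "d \<noteq> zero_chain R' E" for d
    using image_chain_support_contains_elementary[OF P fin C P' \<phi> that] elementary_primitive[OF P C]
    by metis
  \<comment> \<open>A nonzero chain of \<open>?D\<close> with strictly smaller support would, by
    \<open>below\<close>, contain the support of an elementary chain of \<open>C\<close> properly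
    inside that of \<open>c\<close>.\<close>
  have up: "elementary R' E ?D (image_chain E \<phi> c)" if c: "elementary R E C c" "primitive R G E c" for c
    unfolding elementary_def
  proof (intro conjI notI)
    have cC: "c \<in> C" "c \<noteq> zero_chain R E" using c by (auto simp: elementary_def)
    show "image_chain E \<phi> c \<in> ?D" using inD cC by blast
    then show False if "image_chain E \<phi> c = zero_chain R' E"
      using that prim(2)[OF c(2)] chain_support_empty_iff[OF D] chain_support_empty_iff[OF cg cC(1)] cC
      by blast
    assume "\<exists>d\<in>?D. d \<noteq> zero_chain R' E \<and>
      chain_support R' E d \<subset> chain_support R' E (image_chain E \<phi> c)"
    then obtain d where d: "d \<in> ?D" "d \<noteq> zero_chain R' E"
      "chain_support R' E d \<subset> chain_support R E c"
      using prim(2)[OF c(2)] by auto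
    from below[OF d(1,2)] obtain c' where "elementary R E C c'"
      "chain_support R E c' \<subseteq> chain_support R' E d" by blast
    then show False using c(1) d(3) unfolding elementary_def by blast
  qed
  \<comment> \<open>By \<open>up\<close>, the image of the chain \<open>c\<close> found below
    \<open>d\<close> is a nonzero member of \<open>?D\<close> with the support of \<open>c\<close>;
    minimality of \<open>d\<close> excludes strict inclusion.\<close>
  have down: "\<exists>c. elementary R E C c \<and> primitive R G E c \<and> chain_support R E c = chain_support R' E d"
    if d: "elementary R' E ?D d" for d
  proof -
    have "d \<in> ?D" "d \<noteq> zero_chain R' E" using d by (auto simp: elementary_def)
    from below[OF this] obtain c where c: "elementary R E C c" "primitive R G E c"
      "chain_support R E c \<subseteq> chain_support R' E d" by blast
    then show ?thesis using d up[OF c(1,2)] prim(2)[OF c(2)] unfolding elementary_def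
      by (metis psubsetI)
  qed
  have supp: "chain_support R E ` {c. elementary R E C c}
      = chain_support R' E ` {d. elementary R' E ?D d}"
  proof (intro equalityI subsetI)
    fix X assume "X \<in> chain_support R E ` {c. elementary R E C c}"
    then obtain c where c: "elementary R E C c" "primitive R G E c" "X = chain_support R E c"
      using elementary_primitive[OF P C] by (smt (verit) image_iff mem_Collect_eq)
    then show "X \<in> chain_support R' E ` {d. elementary R' E ?D d}"
      using up[OF c(1,2)] prim(2)[OF c(2)] by blast
  next
    fix X assume "X \<in> chain_support R' E ` {d. elementary R' E ?D d}"
    then show "X \<in> chain_support R E ` {c. elementary R E C c}" using down by blast
  qed
  have "\<exists>r\<in>carrier R'. \<exists>c'\<in>?D. primitive R' G' E c' \<and> d = scale_chain R' E r c'"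
    if d: "elementary R' E ?D d" for d
  proof -
    have dD: "d \<in> ?D" "d \<noteq> zero_chain R' E" using d by (auto simp: elementary_def)
    from down[OF d] obtain c where c: "elementary R E C c" "primitive R G E c"
      "chain_support R E c = chain_support R' E d" by blast
    define b where "b = image_chain E \<phi> c"
    have b: "primitive R' G' E b" "chain_support R' E b = chain_support R' E d" "b \<in> ?D"
      using prim[OF c(2)] c inD by (auto simp: b_def elementary_def)
    have "chain_support R' E b \<noteq> {}" using b(2) dD chain_support_empty_iff[OF D] by blast
    then obtain e where e: "e \<in> chain_support R' E b" by blast
    then have eE: "e \<in> E" and u: "b e \<in> Units R'"
      using b(1) skew_partial_field_Units[OF P'] by (auto simp: primitive_def chain_support_def)
    have car: "b f \<in> carrier R'" "d f \<in> carrier R'" if "f \<in> E" for f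
      using chain_group_carrier[OF D _ that] b dD by auto
    \<comment> \<open>Chosen so that \<open>r\<close> times \<open>b e\<close> is
      \<open>d e\<close>. The inverse goes on the right because scalars act from the left.\<close>
    define r where "r = d e \<otimes>\<^bsub>R'\<^esub> inv\<^bsub>R'\<^esub> b e"
    have r: "r \<in> carrier R'" using u car eE by (simp add: r_def)
    \<comment> \<open>The chain \<open>d\<close> minus \<open>r\<close> times \<open>b\<close>
      cancels at \<open>e\<close> and vanishes off the common support, so its support is strictly
      smaller than that of \<open>d\<close>. Since \<open>d\<close> is elementary, \<open>x\<close>
      must be zero, and \<open>d\<close> is a multiple of the primitive chain
      \<open>b\<close>.\<close>
    define x where "x = add_chain R' E d (scale_chain R' E (\<ominus>\<^bsub>R'\<^esub> r) b)"
    have xD: "x \<in> ?D" unfolding x_def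
      using r b dD by (intro chain_group_add[OF D] chain_group_scale[OF D]) auto
    have xf: "x f = d f \<ominus>\<^bsub>R'\<^esub> r \<otimes>\<^bsub>R'\<^esub> b f" if "f \<in> E" for f
      using that r car by (simp add: x_def add_chain_def scale_chain_def a_minus_def R'.l_minus)
    have "r \<otimes>\<^bsub>R'\<^esub> b e = d e" using u car eE by (simp add: r_def R'.m_assoc)
    then have "x e = \<zero>\<^bsub>R'\<^esub>" using xf[OF eE] car eE by (simp add: a_minus_def R'.r_neg)
    moreover have "x f = \<zero>\<^bsub>R'\<^esub>" if f: "f \<in> E" "f \<notin> chain_support R' E d" for f
    proof -
      have "f \<notin> chain_support R' E b" using f b(2) by simp
      then have "b f = \<zero>\<^bsub>R'\<^esub>" "d f = \<zero>\<^bsub>R'\<^esub>" using f by (simp_all add: chain_support_def)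
      then show ?thesis using xf[OF f(1)] r by (simp add: a_minus_def)
    qed
    ultimately have "chain_support R' E x \<subseteq> chain_support R' E d - {e}"
      unfolding chain_support_def[of R' E x] by blast
    then have "chain_support R' E x \<subset> chain_support R' E d" using e b(2) by blast
    then have "x = zero_chain R' E" using d xD by (auto simp: elementary_def)
    then have "d f \<ominus>\<^bsub>R'\<^esub> r \<otimes>\<^bsub>R'\<^esub> b f = \<zero>\<^bsub>R'\<^esub>" if "f \<in> E" for f
      using xf[OF that] that by (simp add: zero_chain_def)
    then have "d f = r \<otimes>\<^bsub>R'\<^esub> b f" if "f \<in> E" for f
      using R'.r_right_minus_eq[of "d f" "r \<otimes>\<^bsub>R'\<^esub> b f"] that car[OF that] r by auto
    \<comment> \<open>Equality as functions also concerns arguments outside \<open>E\<close>, where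
      both sides are \<open>undefined\<close>.\<close>
    moreover have "d \<in> extensional E" using dD D by (auto simp: chain_group_def PiE_def)
    ultimately have "d = scale_chain R' E r b"
      by (intro extensionalityI[of _ E]) (auto simp: scale_chain_def)
    with r b show ?thesis by blast
  qed
  with D have "pf_chain_group R' G' E ?D" by (simp add: pf_chain_group_def)
  \<comment> \<open>\<open>matroid_of\<close> depends on a chain group only through \<open>E\<close>
    and the family of elementary supports, so equal families turn the two descriptions into the same
    one.\<close>
  moreover have "matroid_of R E C = matroid_of R' E ?D"
    unfolding matroid_of_def supp ..
  ultimately show ?thesis ..
qed

end
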